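(* Let $d\ge4$ be divisible by $4$, let $\mathcal{X}=\{0,1\}^d$, and let $\mathcal{H}$ be the set of all functions $h_w:\mathcal{X}\to\{0,1\}$, $h_w(x)=\mathbf{1}[w\cdot x>\frac d4-1]$, where $w$ ranges over the vectors in $\{0,1\}^d$ with exactly $d/2$ entries equal to $1$ and $d/2$ entries equal to $0$; so $n=|\mathcal{H}|=\binom{d}{d/2}$. If the problem $(\mathcal{H},\mathcal{X})$ is $k$-neighborly, then $k\ge\sqrt n$.
   Context: Elements of $\mathcal{H}$ are hypotheses, elements of $\mathcal{X}$ are tests. For tests $x,x'$ let $\Delta(x,x')=\{h\in\mathcal{H}: h(x)=0 \wedge h(x')=1\}$. The problem is $k$-neighborly if the undirected graph on $\mathcal{X}$ with an edge $(x,x')$ whenever $|\Delta(x,x')\cup\Delta(x',x)|\le k$ is connected. *)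

theory Defs
  imports Complex_Main "HOL-Library.FuncSet" "Graph_Theory.Digraph_Component"
begin

definition disagreement :: "('x \<Rightarrow> nat) set \<Rightarrow> 'x \<Rightarrow> 'x \<Rightarrow> ('x \<Rightarrow> nat) set" where
  "disagreement H x x' = {h \<in> H. h x = 0 \<and> h x' = 1}"

(* The arc relation is symmetric, so this digraph represents an undirected graph.
   The finiteness conjunct is needed because card is 0 on infinite sets. *)
definition neighbor_graph :: "nat \<Rightarrow> ('x \<Rightarrow> nat) set \<Rightarrow> 'x set \<Rightarrow> 'x pair_pre_digraph" where
  "neighbor_graph k H X =
     \<lparr> pverts = X,
       parcs = {(x, x'). x \<in> X \<and> x' \<in> X \<and>
                  finite (disagreement H x x' \<union> disagreement H x' x) \<and>
                  card (disagreement H x x' \<union> disagreement H x' x) \<le> k} \<rparr>"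

(* Digraph_Component.connected is qualified to avoid the topological notion of the same name. *)
definition k_neighborly :: "nat \<Rightarrow> ('x \<Rightarrow> nat) set \<Rightarrow> 'x set \<Rightarrow> bool" where
  "k_neighborly k H X \<longleftrightarrow> Digraph_Component.connected (with_proj (neighbor_graph k H X))"

(* {0,1}^d as functions on the index set {0,...,d-1}, extensional so that each
   vector has exactly one representative. *)
definition cube :: "nat \<Rightarrow> (nat \<Rightarrow> nat) set" where
  "cube d = {..<d} \<rightarrow>\<^sub>E {0, 1}"

definition dot :: "nat \<Rightarrow> (nat \<Rightarrow> nat) \<Rightarrow> (nat \<Rightarrow> nat) \<Rightarrow> nat" where
  "dot d w x = (\<Sum>i<d. w i * x i)"

definition balanced :: "nat \<Rightarrow> (nat \<Rightarrow> nat) set" where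
  "balanced d = {w \<in> cube d. card {i. i < d \<and> w i = 1} = d div 2 \<and>
                              card {i. i < d \<and> w i = 0} = d div 2}"

(* Restricting to the cube makes two hypotheses equal iff they agree on every test. *)
definition threshold_hyp :: "nat \<Rightarrow> (nat \<Rightarrow> nat) \<Rightarrow> (nat \<Rightarrow> nat) \<Rightarrow> nat" where
  "threshold_hyp d w = (\<lambda>x\<in>cube d. of_bool (real (dot d w x) > real d / 4 - 1))"

definition threshold_class :: "nat \<Rightarrow> ((nat \<Rightarrow> nat) \<Rightarrow> nat) set" where
  "threshold_class d = threshold_hyp d ` balanced d"

end

(* A test with fewer than d/4 ones is answered 0 by every hypothesis, while a test with at least
   d/4 ones, say on a set containing S with |S| = d/4, is answered 1 by every hypothesis whose
   support contains S. Every path from the zero vector to the all-ones vector has an edge between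
   tests of these two kinds, so with d = 4m it contains an edge on which at least (3m choose m)
   hypotheses disagree; and (4m choose 2m) <= (3m choose m)^2. *)
theory Submission
  imports Defs
begin

section \<open>Counting supersets and estimating binomial coefficients\<close>

text \<open>Removing \<open>S\<close> maps these sets bijectively onto the \<open>k\<close>-subsets
  of \<open>D - S\<close>. With \<open>card D = 4 * m\<close> and \<open>card S = k = m\<close> the
  count is (3m choose m), the number of supports used to bound a disagreement from below.\<close>

lemma card_supersets_of_card:
  assumes "finite D" and "S \<subseteq> D"
  shows "card {A. S \<subseteq> A \<and> A \<subseteq> D \<and> card A = card S + k} = (card D - card S) choose k"
proof -
  have fS: "finite S"
    using assms finite_subset by blast
  have "bij_betw (\<lambda>B. B \<union> S) {B. B \<subseteq> D - S \<and> card B = k}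
          {A. S \<subseteq> A \<and> A \<subseteq> D \<and> card A = card S + k}"
  proof (rule bij_betw_byWitness[where f' = "\<lambda>A. A - S"])
    show "(\<lambda>B. B \<union> S) ` {B. B \<subseteq> D - S \<and> card B = k}
            \<subseteq> {A. S \<subseteq> A \<and> A \<subseteq> D \<and> card A = card S + k}"
    proof clarsimp
      fix B assume B: "B \<subseteq> D - S"
      then have "finite B"
        using assms by (meson finite_Diff finite_subset)
      with B fS have "card (B \<union> S) = card B + card S"
        by (intro card_Un_disjoint) auto
      with B assms show "B \<subseteq> D \<and> S \<subseteq> D \<and> card (B \<union> S) = card S + card B"
        by auto
    qed
  qed (use fS in \<open>auto simp: card_Diff_subset\<close>)
  then have "card {A. S \<subseteq> A \<and> A \<subseteq> D \<and> card A = card S + k} = card {B. B \<subseteq> D - S \<and> card B = k}"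
    by (simp add: bij_betw_same_card)
  also have "\<dots> = (card D - card S) choose k"
    using assms fS by (simp add: n_subsets card_Diff_subset)
  finally show ?thesis .
qed

text \<open>This is the ratio of consecutive terms of (3m choose m), cleared of denominators so that
  it stays in the naturals. It follows by expanding the factorials and cancelling.\<close>

lemma three_times_choose_Suc:
  "(2 * m + 2) * (2 * m + 1) * ((3 * Suc m) choose Suc m)
     = 3 * (3 * m + 2) * (3 * m + 1) * ((3 * m) choose m)"
proof -
  define F :: nat where "F = fact m * fact (2 * m)"
  have F: "F > 0"
    by (simp add: F_def)
  have *: "F * ((3 * m) choose m) = fact (3 * m)"
    using binomial_fact_lemma[of m "3 * m"] by (simp add: F_def mult_2)
  have **: "fact (Suc m) * fact (2 * m + 2) * ((3 * Suc m) choose Suc m) = (fact (3 * Suc m) :: nat)"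
  proof -
    have "3 * Suc m - Suc m = 2 * m + 2" "Suc m \<le> 3 * Suc m"
      by simp_all
    then show ?thesis
      using binomial_fact_lemma[of "Suc m" "3 * Suc m"] by presburger
  qed
  have "fact (2 * m + 2) = (2 * m + 2) * (2 * m + 1) * (fact (2 * m) :: nat)"
    "fact (3 * Suc m) = (3 * m + 3) * (3 * m + 2) * (3 * m + 1) * (fact (3 * m) :: nat)"
    by (simp_all add: eval_nat_numeral fact_Suc algebra_simps)
  \<comment> \<open>The factor \<open>m + 1\<close> occurs on both sides: on the left it comes from
    \<open>fact (Suc m)\<close>, on the right from 3m + 3 = 3(m + 1).\<close>
  with ** have "(m + 1) * F * ((2 * m + 2) * (2 * m + 1) * ((3 * Suc m) choose Suc m))
     = (m + 1) * (3 * (3 * m + 2) * (3 * m + 1)) * (F * ((3 * m) choose m))"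
    unfolding * by (simp add: F_def algebra_simps)
  then have "((m + 1) * F) * ((2 * m + 2) * (2 * m + 1) * ((3 * Suc m) choose Suc m))
     = ((m + 1) * F) * (3 * (3 * m + 2) * (3 * m + 1) * ((3 * m) choose m))"
    by (simp only: mult_ac)
  moreover have "(m + 1) * F \<noteq> 0"
    using F by simp
  ultimately show ?thesis
    by (simp only: mult_left_cancel simp_thms)
qed

text \<open>From m = 1 on, each term is at least 4 times its predecessor. The constant 3/4 makes the
  bound an equality at m = 1.\<close>

lemma three_times_choose_lower_bound:
  assumes "m \<ge> 1"
  shows "3 * 4 ^ m \<le> 4 * ((3 * m) choose m)"
  using assms
proof (induction m rule: nat_induct_at_least)
  case base
  show ?case by simp
next
  case (Suc m)
  let ?p = "(2 * m + 2) * (2 * m + 1)"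
  \<comment> \<open>The right side minus the left side is 11 m^2 + 3 m - 2, which is positive for m
    \<ge> 1 but negative at m = 0; hence the induction starts at 1.\<close>
  have "4 * ?p \<le> 3 * (3 * m + 2) * (3 * m + 1)"
    using Suc.hyps by (simp add: algebra_simps)
  then have "4 * ?p * ((3 * m) choose m) \<le> 3 * (3 * m + 2) * (3 * m + 1) * ((3 * m) choose m)"
    by (rule mult_right_mono) simp
  then have "?p * (4 * ((3 * m) choose m)) \<le> ?p * ((3 * Suc m) choose Suc m)"
    unfolding three_times_choose_Suc by (simp only: mult_ac)
  then have "4 * ((3 * m) choose m) \<le> (3 * Suc m) choose Suc m"
    by (simp only: mult_le_cancel1) simp
  with Suc.IH show ?case
    by simp
qed

text \<open>For n = k + 1 the central coefficient is twice (2k+1 choose k), a single term of the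
  lower half of row 2k + 1, and that half sums to 4^k.\<close>

lemma central_binomial_upper_bound:
  assumes "n \<ge> 1"
  shows "2 * ((2 * n) choose n) \<le> 4 ^ n"
proof -
  obtain k where n: "n = Suc k"
    using assms by (cases n) auto
  have "(2 * k + 1) choose k \<le> (\<Sum>i\<le>k. (2 * k + 1) choose i)"
    by (rule member_le_sum) auto
  also have "\<dots> = 2 ^ (2 * k)"
    by (rule binomial_r_part_sum)
  finally have le: "(2 * k + 1) choose k \<le> 4 ^ k"
    by (simp add: power_mult)
  have "(2 * k + 1) choose (Suc k) = (2 * k + 1) choose k"
    using binomial_symmetric[of k "2 * k + 1"] by simp
  then have "(2 * n) choose n = 2 * ((2 * k + 1) choose k)"
    by (simp add: n)
  with le show ?thesis
    by (simp add: n)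
qed

text \<open>The two exponential bounds meet at 16^m: the left side is at most 16^m / 2, and 16^m is
  at most 16/9 times the right side. This leaves a factor 8/9 to spare.\<close>

lemma choose_half_le_choose_third_square:
  assumes "m \<ge> 1"
  shows "(4 * m) choose (2 * m) \<le> ((3 * m) choose m)\<^sup>2"
proof -
  have "(3 * 4 ^ m)\<^sup>2 \<le> (4 * ((3 * m) choose m))\<^sup>2"
    using three_times_choose_lower_bound[OF assms] by (rule power_mono) simp
  then have "9 * 4 ^ (2 * m) \<le> 16 * ((3 * m) choose m)\<^sup>2"
    by (simp add: power_mult_distrib power_even_eq)
  moreover have "2 * ((4 * m) choose (2 * m)) \<le> 4 ^ (2 * m)"
    using central_binomial_upper_bound[of "2 * m"] assms by simp
  ultimately show ?thesis
    by linarith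
qed

section \<open>Crossing arcs in connected graphs\<close>

text \<open>Along a walk from \<open>u\<close> to \<open>v\<close> the property \<open>P\<close> is
  lost at some step. Connectedness is strong connectedness of the symmetric closure, so the arc of
  \<open>G\<close> itself may point either way.\<close>

lemma connected_crossing_arc:
  assumes "Digraph_Component.connected (with_proj G)"
    and "u \<in> pverts G" "v \<in> pverts G" "P u" "\<not> P v"
  obtains x y where "P x" "\<not> P y" "(x, y) \<in> parcs G \<or> (y, x) \<in> parcs G"
proof -
  have "(u, v) \<in> (parcs (mk_symmetric (with_proj G)))\<^sup>*"
    using assms(1-3) reachable_rtranclI[of "with_proj (mk_symmetric (with_proj G))" u v]
    unfolding connected_def strongly_connected_def by simp
  then have "\<exists>x y. P x \<and> \<not> P y \<and> (x, y) \<in> parcs (mk_symmetric (with_proj G))"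
    using assms(4,5) by (induction rule: rtrancl_induct) blast+
  then show ?thesis
    using that unfolding parcs_mk_symmetric by auto
qed

section \<open>Binary vectors as subsets of the index set\<close>

text \<open>The restriction to \<open>{..<d}\<close> yields the extensional representative required
  by \<open>cube\<close>, so tests and weight vectors can both be replaced by their
  supports.\<close>

definition indicator_vec :: "nat \<Rightarrow> nat set \<Rightarrow> nat \<Rightarrow> nat" where
  "indicator_vec d A = (\<lambda>i\<in>{..<d}. of_bool (i \<in> A))"

lemma indicator_vec_in_cube: "indicator_vec d A \<in> cube d"
  by (auto simp: indicator_vec_def cube_def)

text \<open>The bound \<open>i < d\<close> stands on both sides so that the equivalence rewrites the
  bodies of the set comprehensions in \<open>balanced\<close>.\<close>

lemma indicator_vec_eq_1_iff: "i < d \<and> indicator_vec d A i = 1 \<longleftrightarrow> i < d \<and> i \<in> A"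
  by (auto simp: indicator_vec_def)

lemma indicator_vec_eq_0_iff: "i < d \<and> indicator_vec d A i = 0 \<longleftrightarrow> i < d \<and> i \<notin> A"
  by (auto simp: indicator_vec_def)

lemma indicator_vec_support:
  assumes "x \<in> cube d"
  shows "indicator_vec d {i. i < d \<and> x i = 1} = x"
proof
  fix i
  show "indicator_vec d {i. i < d \<and> x i = 1} i = x i"
    using assms by (cases "i < d") (auto simp: indicator_vec_def cube_def PiE_iff extensional_def)
qed

lemma cube_eq: "cube d = indicator_vec d ` Pow {..<d}"
proof (intro subset_antisym subsetI)
  fix x assume "x \<in> cube d"
  then have "x = indicator_vec d {i. i < d \<and> x i = 1}"
    using indicator_vec_support[of x d] by simp
  then show "x \<in> indicator_vec d ` Pow {..<d}"
    by (rule image_eqI) auto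
qed (auto simp: indicator_vec_in_cube)

lemma dot_indicator_vec:
  assumes "A \<subseteq> {..<d}"
  shows "dot d (indicator_vec d A) (indicator_vec d B) = card (A \<inter> B)"
proof -
  have "dot d (indicator_vec d A) (indicator_vec d B) = (\<Sum>i<d. of_bool (i \<in> A \<inter> B))"
    unfolding dot_def by (intro sum.cong) (auto simp: indicator_vec_def)
  also have "\<dots> = card ({..<d} \<inter> (A \<inter> B))"
    by (simp add: Int_def)
  also have "{..<d} \<inter> (A \<inter> B) = A \<inter> B"
    using assms by auto
  finally show ?thesis .
qed

lemma balanced_eq:
  assumes "even d"
  shows "balanced d = indicator_vec d ` {A. A \<subseteq> {..<d} \<and> card A = d div 2}"
proof (intro subset_antisym subsetI)
  fix w assume w: "w \<in> balanced d"
  then have "w = indicator_vec d {i. i < d \<and> w i = 1}"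
    using indicator_vec_support[of w d] by (simp add: balanced_def)
  then show "w \<in> indicator_vec d ` {A. A \<subseteq> {..<d} \<and> card A = d div 2}"
    by (rule image_eqI) (use w in \<open>auto simp: balanced_def\<close>)
next
  fix w assume "w \<in> indicator_vec d ` {A. A \<subseteq> {..<d} \<and> card A = d div 2}"
  then obtain A where w: "w = indicator_vec d A" and A: "A \<subseteq> {..<d}" "card A = d div 2"
    by auto
  have "{i. i < d \<and> i \<in> A} = A" "{i. i < d \<and> i \<notin> A} = {..<d} - A"
    using A by auto
  \<comment> \<open>Evenness of \<open>d\<close> enters here: the complement of a half-size set
    again has size \<open>d div 2\<close>.\<close>
  moreover have "card ({..<d} - A) = d div 2"
    using A assms by (subst card_Diff_subset) (auto intro: finite_subset)
  ultimately show "w \<in> balanced d"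
    using A unfolding balanced_def w mem_Collect_eq indicator_vec_eq_1_iff indicator_vec_eq_0_iff
    by (simp add: indicator_vec_in_cube)
qed

section \<open>Threshold hypotheses as conditions on intersections\<close>

text \<open>The real threshold is m - 1 and the dot product is the natural number
  \<open>card (A \<inter> B)\<close>, so exceeding the threshold means reaching
  \<open>m\<close>.\<close>

lemma threshold_hyp_indicator_vec:
  assumes "d = 4 * m" and "A \<subseteq> {..<d}"
  shows "threshold_hyp d (indicator_vec d A) (indicator_vec d B) = of_bool (m \<le> card (A \<inter> B))"
proof -
  have "real (dot d (indicator_vec d A) (indicator_vec d B)) > real d / 4 - 1
          \<longleftrightarrow> m \<le> card (A \<inter> B)"
    using assms by (simp add: dot_indicator_vec) linarith
  then show ?thesis
    by (simp add: threshold_hyp_def indicator_vec_in_cube)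
qed

text \<open>Two distinct supports of equal size are separated by a test on \<open>m\<close> points
  of the first, one of which lies outside the second. Injectivity allows hypotheses to be counted by
  their supports.\<close>

lemma inj_on_threshold_hyp:
  assumes d: "d = 4 * m" and m: "m \<ge> 1"
  shows "inj_on (\<lambda>A. threshold_hyp d (indicator_vec d A)) {A. A \<subseteq> {..<d} \<and> card A = 2 * m}"
proof (rule inj_onI, rule ccontr)
  fix A B
  assume A: "A \<in> {A. A \<subseteq> {..<d} \<and> card A = 2 * m}"
    and B: "B \<in> {A. A \<subseteq> {..<d} \<and> card A = 2 * m}"
    and eq: "threshold_hyp d (indicator_vec d A) = threshold_hyp d (indicator_vec d B)"
    and ne: "A \<noteq> B"
  have fin: "finite A" "finite B"
    using A B by (auto intro: finite_subset)
  have "card A = card B"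
    using A B by simp
  then have "\<not> A \<subseteq> B"
    using ne card_subset_eq[OF fin(2)] by blast
  then obtain a where a: "a \<in> A" "a \<notin> B"
    by blast
  obtain S where S: "{a} \<subseteq> S" "S \<subseteq> A" "card S = m"
    using exists_subset_between[of "{a}" m A] A a(1) fin m by auto
  have fS: "finite S"
    using S(2) fin(1) by (rule finite_subset)
  have "A \<inter> S = S"
    using S by auto
  \<comment> \<open>The point \<open>a\<close> lies in \<open>S\<close> but not in \<open>B\<close>,
    so the intersection is a proper subset of \<open>S\<close>.\<close>
  moreover have "card (B \<inter> S) < m"
    using psubset_card_mono[OF fS, of "B \<inter> S"] S a by auto
  ultimately have "threshold_hyp d (indicator_vec d A) (indicator_vec d S)
      \<noteq> threshold_hyp d (indicator_vec d B) (indicator_vec d S)"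
    using A B S by (simp add: threshold_hyp_indicator_vec[OF d])
  with eq show False
    by simp
qed

lemma threshold_class_eq:
  assumes "d = 4 * m"
  shows "threshold_class d
    = (\<lambda>A. threshold_hyp d (indicator_vec d A)) ` {A. A \<subseteq> {..<d} \<and> card A = 2 * m}"
  using assms by (simp add: threshold_class_def balanced_eq image_image)

lemma card_threshold_class:
  assumes "d = 4 * m" and "m \<ge> 1"
  shows "card (threshold_class d) = d choose (2 * m)"
  using assms by (simp add: threshold_class_eq card_image inj_on_threshold_hyp n_subsets)

section \<open>Disagreement across the weight threshold\<close>

lemma card_disagreement_ge:
  assumes d: "d = 4 * m" and m: "m \<ge> 1"
    and Y: "Y \<subseteq> {..<d}" "card Y < m" and X: "X \<subseteq> {..<d}" "m \<le> card X"
  shows "(3 * m) choose m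
    \<le> card (disagreement (threshold_class d) (indicator_vec d Y) (indicator_vec d X))"
proof -
  obtain S where S: "S \<subseteq> X" "card S = m"
    using obtain_subset_with_card_n[OF X(2)] by metis
  let ?h = "\<lambda>A. threshold_hyp d (indicator_vec d A)"
  \<comment> \<open>Here \<open>card S + m\<close> equals 2m, the size of a balanced support; this
    form matches the superset count.\<close>
  let ?As = "{A. S \<subseteq> A \<and> A \<subseteq> {..<d} \<and> card A = card S + m}"
  let ?D = "disagreement (threshold_class d) (indicator_vec d Y) (indicator_vec d X)"
  have sub: "?As \<subseteq> {A. A \<subseteq> {..<d} \<and> card A = 2 * m}"
    using S by auto
  have "?h A \<in> ?D" if A: "A \<in> ?As" for A
  proof -
    have "finite Y" "finite X"
      using X Y by (auto intro: finite_subset)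
    then have "card (A \<inter> Y) < m" "m \<le> card (A \<inter> X)"
      using Y card_mono[of Y "A \<inter> Y"] A S card_mono[of "A \<inter> X" S] by auto
    then have "?h A (indicator_vec d Y) = 0" "?h A (indicator_vec d X) = 1"
      using A by (simp_all add: threshold_hyp_indicator_vec[OF d])
    moreover have "?h A \<in> threshold_class d"
      unfolding threshold_class_eq[OF d] using A sub by blast
    ultimately show ?thesis
      by (simp add: disagreement_def)
  qed
  then have "?h ` ?As \<subseteq> ?D"
    by blast
  moreover have "finite ?D"
    by (simp add: disagreement_def threshold_class_eq[OF d])
  ultimately have "card (?h ` ?As) \<le> card ?D"
    by (rule card_mono[rotated])
  moreover have "card (?h ` ?As) = card ?As"
    by (rule card_image[OF inj_on_subset[OF inj_on_threshold_hyp[OF d m] sub]])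
  moreover have "card ?As = (3 * m) choose m"
    using card_supersets_of_card[of "{..<d}" S m] S X d by auto
  ultimately show ?thesis
    by simp
qed

lemma k_neighborly_threshold_class:
  assumes d: "d = 4 * m" and m: "m \<ge> 1" and "k_neighborly k (threshold_class d) (cube d)"
  shows "(3 * m) choose m \<le> k"
proof -
  let ?H = "threshold_class d"
  \<comment> \<open>This says that the test has fewer than d/4 ones, expressed through its
    support.\<close>
  let ?P = "\<lambda>x. \<exists>Y\<subseteq>{..<d}. card Y < m \<and> x = indicator_vec d Y"
  have P_zero: "?P (indicator_vec d {})"
    using m by (intro exI[of _ "{}"]) auto
  have not_P_ones: "\<not> ?P (indicator_vec d {..<d})"
  proof
    assume "?P (indicator_vec d {..<d})"
    then obtain Y where Y: "Y \<subseteq> {..<d}" "card Y < m" "indicator_vec d {..<d} = indicator_vec d Y"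
      by auto
    have "{..<d} \<subseteq> Y"
      using indicator_vec_eq_1_iff[of _ d "{..<d}"] indicator_vec_eq_1_iff[of _ d Y] Y(3) by auto
    with Y(1) have "card Y = d"
      by (simp add: subset_antisym)
    with Y(2) d show False
      by simp
  qed
  have conn: "Digraph_Component.connected (with_proj (neighbor_graph k ?H (cube d)))"
    using assms(3) by (simp only: k_neighborly_def)
  have verts: "indicator_vec d A \<in> pverts (neighbor_graph k ?H (cube d))" for A
    by (simp add: neighbor_graph_def indicator_vec_in_cube)
  obtain y x where y: "?P y" and x: "\<not> ?P x"
    and arc: "(y, x) \<in> parcs (neighbor_graph k ?H (cube d))
      \<or> (x, y) \<in> parcs (neighbor_graph k ?H (cube d))"
    by (rule connected_crossing_arc[where P = ?P, OF conn verts verts P_zero not_P_ones])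
  obtain Y where Y: "Y \<subseteq> {..<d}" "card Y < m" "y = indicator_vec d Y"
    using y by blast
  have "x \<in> cube d"
    using arc by (auto simp: neighbor_graph_def)
  then obtain X where X: "X \<subseteq> {..<d}" "x = indicator_vec d X"
    unfolding cube_eq by blast
  with x have "m \<le> card X"
    by (auto simp: not_less[symmetric])
  then have "(3 * m) choose m \<le> card (disagreement ?H y x)"
    unfolding X(2) Y(3) using card_disagreement_ge[OF d m Y(1,2) X(1)] by blast
  \<comment> \<open>Monotonicity of \<open>card\<close> needs the union to be finite, which the arc
    relation itself supplies.\<close>
  also have "\<dots> \<le> card (disagreement ?H y x \<union> disagreement ?H x y)"
    by (rule card_mono) (use arc in \<open>auto simp: neighbor_graph_def\<close>)
  also have "\<dots> \<le> k"
    using arc by (auto simp: neighbor_graph_def Un_commute)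
  finally show ?thesis .
qed

theorem mainTheorem13:
  fixes d :: nat
  assumes "d \<ge> 4" and "4 dvd d"
  shows "card (threshold_class d) = d choose (d div 2) \<and>
         (\<forall>k. k_neighborly k (threshold_class d) (cube d) \<longrightarrow>
              real k \<ge> sqrt (real (card (threshold_class d))))"
proof -
  obtain m where d: "d = 4 * m"
    using assms(2) by auto
  with assms(1) have m: "m \<ge> 1"
    by simp
  have card: "card (threshold_class d) = d choose (2 * m)"
    using card_threshold_class[OF d m] .
  have "sqrt (real (card (threshold_class d))) \<le> real k"
    if "k_neighborly k (threshold_class d) (cube d)" for k
  proof -
    have "card (threshold_class d) \<le> ((3 * m) choose m)\<^sup>2"
      using choose_half_le_choose_third_square[OF m] by (simp only: card) (simp add: d)
    also have "\<dots> \<le> k\<^sup>2"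
      using k_neighborly_threshold_class[OF d m that] by (rule power_mono) simp
    finally have "real (card (threshold_class d)) \<le> (real k)\<^sup>2"
      by (metis of_nat_le_iff of_nat_power)
    then show ?thesis
      by (simp add: real_le_lsqrt)
  qed
  with card d show ?thesis
    by simp
qed

end
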